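(* Assume ZFC is consistent. The set $choice_h^{1,1}$ of Ackermann axioms is HPL-independent of $AC^{1,1}$: there exist a second-order formula $H(x,D)$ and a second-order Henkin–Asser structure that is a model of ${}^hax^{(2)}$ and $AC^{1,1}$ but does not satisfy $choice_h^{1,1}(H)$; and there exists a second-order Henkin–Asser structure (the basic Fraenkel model $\Sigma_0$) that is a model of ${}^hax^{(2)}\cup choice_h^{1,1}\cup\{AC^{1,1}\}$.
   Context: Work in second-order predicate logic with Henkin interpretation; ${}^hax^{(2)}$ is its axiom system, and a Henkin–Asser structure is a structure $(J_k)_{k\ge0}$ with nonempty individual domain $J_0$ and sets $J_k$ of $k$-ary predicates over which $k$-ary predicate variables range, closed under second-order definability. The basic Fraenkel model of second order is $\Sigma_0=\Sigma(\mathbb{N},\mathfrak{G},{\cal I}_0)$ where $\mathfrak{G}$ is the group of all permutations of $\mathbb{N}$, ${\cal I}_0$ the finite subsets of $\mathbb{N}$, and $J_n$ consists of the $n$-ary predicates on $\mathbb{N}$ fixed by every $\pi\in\mathfrak{G}$ that fixes some finite set pointwise. $\exists!!$ means "there exists exactly one". $AC^{1,1}=\forall A\forall R\exists S(\forall x(Ax\leftrightarrow\exists yRxy)\to\forall x(Ax\to\exists!!y(Rxy\land Sxy)))$ with $A$ unary and $R,S$ binary. $choice_h^{1,1}(H)=\forall x\exists D H(x,D)\to\exists S\forall x\exists D(\forall y(Dy\leftrightarrow Sxy)\land H(x,D))$ with $D$ unary and $S$ binary, for any second-order formula $H$ in which the individual variable $x$ and $D$ occur free (possibly with further free variables; "does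 not satisfy" means false under some assignment); $choice_h^{1,1}$ is the set of all these. *)

theory Defs
  imports Main
begin

text \<open>
  Second-order formulas with named variables.  Individual variables are natural numbers;
  a predicate variable \<open>PV n i\<close> is the \<open>i\<close>-th variable of arity \<open>n\<close>.  Only arities \<open>n \<ge> 1\<close> are
  meaningful, which is enforced by \<open>wff\<close>.
\<close>

datatype pvar = PV (arity: nat) (pindex: nat)

datatype fm =
    Pred pvar "nat list"
  | IEq nat nat
  | PEq pvar pvar
  | Neg fm
  | Conj fm fm
  | Disj fm fm
  | Imp fm fm
  | Iff fm fm
  | AllI nat fm
  | ExI nat fm
  | AllP pvar fm
  | ExP pvar fm

primrec wff :: "fm \<Rightarrow> bool" where
  "wff (Pred A xs) \<longleftrightarrow> 1 \<le> arity A \<and> length xs = arity A"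
| "wff (IEq x y) \<longleftrightarrow> True"
| "wff (PEq A B) \<longleftrightarrow> 1 \<le> arity A \<and> arity A = arity B"
| "wff (Neg p) \<longleftrightarrow> wff p"
| "wff (Conj p q) \<longleftrightarrow> wff p \<and> wff q"
| "wff (Disj p q) \<longleftrightarrow> wff p \<and> wff q"
| "wff (Imp p q) \<longleftrightarrow> wff p \<and> wff q"
| "wff (Iff p q) \<longleftrightarrow> wff p \<and> wff q"
| "wff (AllI x p) \<longleftrightarrow> wff p"
| "wff (ExI x p) \<longleftrightarrow> wff p"
| "wff (AllP A p) \<longleftrightarrow> 1 \<le> arity A \<and> wff p"
| "wff (ExP A p) \<longleftrightarrow> 1 \<le> arity A \<and> wff p"

primrec free_ivars :: "fm \<Rightarrow> nat set" where
  "free_ivars (Pred A xs) = set xs"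
| "free_ivars (IEq x y) = {x, y}"
| "free_ivars (PEq A B) = {}"
| "free_ivars (Neg p) = free_ivars p"
| "free_ivars (Conj p q) = free_ivars p \<union> free_ivars q"
| "free_ivars (Disj p q) = free_ivars p \<union> free_ivars q"
| "free_ivars (Imp p q) = free_ivars p \<union> free_ivars q"
| "free_ivars (Iff p q) = free_ivars p \<union> free_ivars q"
| "free_ivars (AllI x p) = free_ivars p - {x}"
| "free_ivars (ExI x p) = free_ivars p - {x}"
| "free_ivars (AllP A p) = free_ivars p"
| "free_ivars (ExP A p) = free_ivars p"

primrec free_pvars :: "fm \<Rightarrow> pvar set" where
  "free_pvars (Pred A xs) = {A}"
| "free_pvars (IEq x y) = {}"
| "free_pvars (PEq A B) = {A, B}"
| "free_pvars (Neg p) = free_pvars p"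
| "free_pvars (Conj p q) = free_pvars p \<union> free_pvars q"
| "free_pvars (Disj p q) = free_pvars p \<union> free_pvars q"
| "free_pvars (Imp p q) = free_pvars p \<union> free_pvars q"
| "free_pvars (Iff p q) = free_pvars p \<union> free_pvars q"
| "free_pvars (AllI x p) = free_pvars p"
| "free_pvars (ExI x p) = free_pvars p"
| "free_pvars (AllP A p) = free_pvars p - {A}"
| "free_pvars (ExP A p) = free_pvars p - {A}"

text \<open>
  A structure \<open>(J\<^sub>k)\<close>, \<open>k \<ge> 0\<close>, has \<open>J\<^sub>0 = indiv M\<close> and \<open>J\<^sub>n = preds M n\<close> for \<open>n \<ge> 1\<close>; the value
  \<open>preds M 0\<close> is irrelevant.  An \<open>n\<close>-ary predicate on \<open>J\<^sub>0\<close> is represented by its extension, a set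
  of lists of length \<open>n\<close> over \<open>J\<^sub>0\<close>.
\<close>

record 'a pstruct =
  indiv :: "'a set"
  preds :: "nat \<Rightarrow> 'a list set set"

definition tuples :: "'a set \<Rightarrow> nat \<Rightarrow> 'a list set" where
  "tuples I n = {as. length as = n \<and> set as \<subseteq> I}"

primrec sat :: "'a pstruct \<Rightarrow> (nat \<Rightarrow> 'a) \<Rightarrow> (pvar \<Rightarrow> 'a list set) \<Rightarrow> fm \<Rightarrow> bool" where
  "sat M f V (Pred A xs) \<longleftrightarrow> map f xs \<in> V A"
| "sat M f V (IEq x y) \<longleftrightarrow> f x = f y"
| "sat M f V (PEq A B) \<longleftrightarrow> V A = V B"
| "sat M f V (Neg p) \<longleftrightarrow> \<not> sat M f V p"
| "sat M f V (Conj p q) \<longleftrightarrow> sat M f V p \<and> sat M f V q"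
| "sat M f V (Disj p q) \<longleftrightarrow> sat M f V p \<or> sat M f V q"
| "sat M f V (Imp p q) \<longleftrightarrow> (sat M f V p \<longrightarrow> sat M f V q)"
| "sat M f V (Iff p q) \<longleftrightarrow> (sat M f V p \<longleftrightarrow> sat M f V q)"
| "sat M f V (AllI x p) \<longleftrightarrow> (\<forall>a\<in>indiv M. sat M (f(x := a)) V p)"
| "sat M f V (ExI x p) \<longleftrightarrow> (\<exists>a\<in>indiv M. sat M (f(x := a)) V p)"
| "sat M f V (AllP A p) \<longleftrightarrow> (\<forall>\<alpha>\<in>preds M (arity A). sat M f (V(A := \<alpha>)) p)"
| "sat M f V (ExP A p) \<longleftrightarrow> (\<exists>\<alpha>\<in>preds M (arity A). sat M f (V(A := \<alpha>)) p)"

definition assignment :: "'a pstruct \<Rightarrow> (nat \<Rightarrow> 'a) \<Rightarrow> (pvar \<Rightarrow> 'a list set) \<Rightarrow> bool" where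
  "assignment M f V \<longleftrightarrow>
     (\<forall>x. f x \<in> indiv M) \<and> (\<forall>A. 1 \<le> arity A \<longrightarrow> V A \<in> preds M (arity A))"

definition satisfies :: "'a pstruct \<Rightarrow> fm \<Rightarrow> bool" where
  "satisfies M p \<longleftrightarrow> (\<forall>f V. assignment M f V \<longrightarrow> sat M f V p)"

definition model_of :: "'a pstruct \<Rightarrow> fm set \<Rightarrow> bool" where
  "model_of M T \<longleftrightarrow> (\<forall>p\<in>T. satisfies M p)"

definition predicate_structure :: "'a pstruct \<Rightarrow> bool" where
  "predicate_structure M \<longleftrightarrow>
     indiv M \<noteq> {} \<and>
     (\<forall>n\<ge>1. preds M n \<noteq> {} \<and> (\<forall>\<alpha>\<in>preds M n. \<alpha> \<subseteq> tuples (indiv M) n))"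

text \<open>
  The predicate defined by \<open>H(x\<^sub>1,\<dots>,x\<^sub>n)\<close>, where \<open>xs = [x\<^sub>1,\<dots>,x\<^sub>n]\<close> are distinct and all other free
  variables of \<open>H\<close> are parameters evaluated by the assignment \<open>f, V\<close>.
\<close>

definition defined_predicate ::
  "'a pstruct \<Rightarrow> (nat \<Rightarrow> 'a) \<Rightarrow> (pvar \<Rightarrow> 'a list set) \<Rightarrow> nat list \<Rightarrow> fm \<Rightarrow> 'a list set" where
  "defined_predicate M f V xs H =
     {map g xs | g. (\<forall>y. g y \<in> indiv M) \<and> (\<forall>y. y \<notin> set xs \<longrightarrow> g y = f y) \<and> sat M g V H}"

definition henkin_asser_structure :: "'a pstruct \<Rightarrow> bool" where
  "henkin_asser_structure M \<longleftrightarrow>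
     predicate_structure M \<and>
     (\<forall>H xs f V. wff H \<and> xs \<noteq> [] \<and> distinct xs \<and> assignment M f V \<longrightarrow>
        defined_predicate M f V xs H \<in> preds M (length xs))"

text \<open>
  The non-logical content of the axiom system: comprehension and extensionality for all arities.
  The remaining axioms (propositional, quantifier and identity axioms) hold in every structure.
\<close>

definition comprehension :: "fm set" where
  "comprehension =
     {ExP A (foldr AllI xs (Iff (Pred A xs) H)) | A xs H.
        wff H \<and> xs \<noteq> [] \<and> distinct xs \<and> arity A = length xs \<and> A \<notin> free_pvars H}"

definition extensionality :: "fm set" where
  "extensionality =
     {AllP A (AllP B (Imp (foldr AllI xs (Iff (Pred A xs) (Pred B xs))) (PEq A B))) | A B xs.
        xs \<noteq> [] \<and> distinct xs \<and> arity A = length xs \<and> arity B = length xs}"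

definition hax2 :: "fm set" where
  "hax2 = comprehension \<union> extensionality"

text \<open>\<open>\<exists>!!y p\<close>, written as \<open>\<exists>z \<forall>y (p \<leftrightarrow> y = z)\<close>; the auxiliary \<open>z\<close> must not be free in \<open>p\<close>.\<close>

definition Ex1I :: "nat \<Rightarrow> nat \<Rightarrow> fm \<Rightarrow> fm" where
  "Ex1I z y p = ExI z (AllI y (Iff p (IEq y z)))"

definition AC11 :: fm where
  "AC11 =
     (let A = PV 1 0; R = PV 2 0; S = PV 2 1; x = 0; y = 1; z = 2 in
        AllP A (AllP R (ExP S
          (Imp (AllI x (Iff (Pred A [x]) (ExI y (Pred R [x, y]))))
               (AllI x (Imp (Pred A [x])
                            (Ex1I z y (Conj (Pred R [x, y]) (Pred S [x, y])))))))))"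

text \<open>
  \<open>choice_h x y D S H\<close> is the Ackermann axiom for \<open>H(x,D)\<close>; the side condition \<open>choice_vars\<close>
  says that \<open>x\<close> and \<open>D\<close> occur free in \<open>H\<close> and that the bound variables \<open>y\<close> and \<open>S\<close> are chosen
  so that nothing is captured.  Further free variables of \<open>H\<close> remain free in the axiom.
\<close>

definition choice_vars :: "nat \<Rightarrow> nat \<Rightarrow> pvar \<Rightarrow> pvar \<Rightarrow> fm \<Rightarrow> bool" where
  "choice_vars x y D S H \<longleftrightarrow>
     wff H \<and> arity D = 1 \<and> arity S = 2 \<and> x \<noteq> y \<and>
     x \<in> free_ivars H \<and> D \<in> free_pvars H \<and> S \<notin> free_pvars H"

definition choice_h :: "nat \<Rightarrow> nat \<Rightarrow> pvar \<Rightarrow> pvar \<Rightarrow> fm \<Rightarrow> fm" where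
  "choice_h x y D S H =
     Imp (AllI x (ExP D H))
         (ExP S (AllI x (ExP D (Conj (AllI y (Iff (Pred D [y]) (Pred S [x, y]))) H))))"

definition choice_h11 :: "fm set" where
  "choice_h11 = {choice_h x y D S H | x y D S H. choice_vars x y D S H}"

text \<open>
  The permutation model \<open>\<Sigma>(I, G, \<I>)\<close>: a permutation \<open>\<pi>\<close> acts on a predicate componentwise on its
  tuples, and \<open>J\<^sub>n\<close> consists of the predicates whose stabilizer contains the pointwise stabilizer
  in \<open>G\<close> of some member of \<open>\<I>\<close>.
\<close>

definition Sigma_struct :: "'a set \<Rightarrow> ('a \<Rightarrow> 'a) set \<Rightarrow> 'a set set \<Rightarrow> 'a pstruct" where
  "Sigma_struct I G \<I> =
     \<lparr>indiv = I,
      preds = (\<lambda>n. {\<alpha>. \<alpha> \<subseteq> tuples I n \<and>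
        (\<exists>P\<in>\<I>. \<forall>\<pi>\<in>G. (\<forall>a\<in>P. \<pi> a = a) \<longrightarrow> map \<pi> ` \<alpha> = \<alpha>)})\<rparr>"

definition Sigma0 :: "nat pstruct" where
  "Sigma0 = Sigma_struct UNIV {\<pi>. bij \<pi>} {P. finite P}"

end

theory Submission
  imports Defs "HOL-Combinatorics.Transposition" "HOL-Library.Discrete_Functions"
begin

text \<open>
  Partition the individuals into blocks, let the group of block-preserving permutations act, and
  admit as supports the sets that meet all blocks in at most \<open>k\<close> points for some common \<open>k\<close>.  Every
  such model satisfies \<open>AC\<^bsup>1,1\<^esup>\<close>: after two further points of each block are added to a support \<open>P\<close>
  of \<open>R\<close>, each nonempty section \<open>R\<^sub>x\<close> contains \<open>x\<close> or a point of the enlarged support.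

  With a single block this is the basic Fraenkel model, where a choice \<open>D\<close> made for one generic \<open>x\<close>
  can be transported to all others by transpositions.  With finite even blocks of unbounded size, let
  \<open>H(x,D)\<close> say that \<open>D\<close> contains exactly half of the block of \<open>x\<close>.  Each single block can be halved,
  since its whole set of points is an admissible support; but no binary predicate halves all blocks,
  since the bound \<open>k\<close> of its support is exceeded by half of a sufficiently large block.
\<close>

section \<open>Satisfaction in Henkin structures\<close>

lemma finite_free_ivars: "finite (free_ivars p)"
  by (induction p) auto

lemma finite_free_pvars: "finite (free_pvars p)"
  by (induction p) auto

lemma wff_free_pvars_arity: "wff p \<Longrightarrow> A \<in> free_pvars p \<Longrightarrow> 1 \<le> arity A"
  by (induction p) auto

lemma sat_cong:
  assumes "\<And>x. x \<in> free_ivars p \<Longrightarrow> f x = g x"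
    and "\<And>A. A \<in> free_pvars p \<Longrightarrow> V A = W A"
  shows "sat M f V p = sat M g W p"
  using assms
proof (induction p arbitrary: f g V W)
  case (Pred A xs)
  then have "map f xs = map g xs" "V A = W A" by auto
  then show ?case by (simp only: sat.simps)
next
  case (AllI x p)
  have "sat M (f(x := a)) V p = sat M (g(x := a)) W p" for a
    by (rule AllI.IH) (use AllI.prems in auto)
  then show ?case by simp
next
  case (ExI x p)
  have "sat M (f(x := a)) V p = sat M (g(x := a)) W p" for a
    by (rule ExI.IH) (use ExI.prems in auto)
  then show ?case by simp
next
  case (AllP A p)
  have "sat M f (V(A := \<alpha>)) p = sat M g (W(A := \<alpha>)) p" for \<alpha>
    by (rule AllP.IH) (use AllP.prems in auto)
  then show ?case by simp
next
  case (ExP A p)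
  have "sat M f (V(A := \<alpha>)) p = sat M g (W(A := \<alpha>)) p" for \<alpha>
    by (rule ExP.IH) (use ExP.prems in auto)
  then show ?case by simp
next
  case (Neg p)
  have "sat M f V p = sat M g W p" by (rule Neg.IH) (use Neg.prems in auto)
  then show ?case by simp
next
  case (Conj p q)
  have "sat M f V p = sat M g W p" by (rule Conj.IH) (use Conj.prems in auto)
  moreover have "sat M f V q = sat M g W q" by (rule Conj.IH) (use Conj.prems in auto)
  ultimately show ?case by simp
next
  case (Disj p q)
  have "sat M f V p = sat M g W p" by (rule Disj.IH) (use Disj.prems in auto)
  moreover have "sat M f V q = sat M g W q" by (rule Disj.IH) (use Disj.prems in auto)
  ultimately show ?case by simp
next
  case (Imp p q)
  have "sat M f V p = sat M g W p" by (rule Imp.IH) (use Imp.prems in auto)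
  moreover have "sat M f V q = sat M g W q" by (rule Imp.IH) (use Imp.prems in auto)
  ultimately show ?case by simp
next
  case (Iff p q)
  have "sat M f V p = sat M g W p" by (rule Iff.IH) (use Iff.prems in auto)
  moreover have "sat M f V q = sat M g W q" by (rule Iff.IH) (use Iff.prems in auto)
  ultimately show ?case by simp
qed auto

text \<open>The right-hand side ranges over the same assignments \<open>g\<close> as
  \<open>defined_predicate\<close>, so comprehension and extensionality can be checked without
  unfolding the quantifier prefix.\<close>

lemma sat_foldr_AllI:
  assumes "\<forall>y. f y \<in> indiv M"
  shows "sat M f V (foldr AllI xs p) \<longleftrightarrow>
    (\<forall>g. (\<forall>y. g y \<in> indiv M) \<and> (\<forall>y. y \<notin> set xs \<longrightarrow> g y = f y) \<longrightarrow> sat M g V p)"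
  using assms
proof (induction xs arbitrary: f)
  case Nil
  show ?case
  proof
    assume "sat M f V (foldr AllI [] p)"
    moreover have "g = f" if "\<forall>y. y \<notin> set [] \<longrightarrow> g y = f y" for g
      using that by auto
    ultimately show "\<forall>g. (\<forall>y. g y \<in> indiv M) \<and> (\<forall>y. y \<notin> set [] \<longrightarrow> g y = f y) \<longrightarrow> sat M g V p"
      by auto
  qed (use Nil in auto)
next
  case (Cons x xs)
  have IH: "sat M (f(x := a)) V (foldr AllI xs p) \<longleftrightarrow>
    (\<forall>g. (\<forall>y. g y \<in> indiv M) \<and> (\<forall>y. y \<notin> set xs \<longrightarrow> g y = (f(x := a)) y) \<longrightarrow> sat M g V p)"
    if "a \<in> indiv M" for a
    by (rule Cons.IH) (use Cons.prems that in auto)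
  show ?case (is "?L \<longleftrightarrow> ?R")
  proof
    assume L: ?L
    show ?R
    proof (intro allI impI, elim conjE)
      fix g
      assume g: "\<forall>y. g y \<in> indiv M" "\<forall>y. y \<notin> set (x # xs) \<longrightarrow> g y = f y"
      have "sat M (f(x := g x)) V (foldr AllI xs p)" using L g by simp
      then show "sat M g V p" using IH[of "g x"] g by auto
    qed
  next
    assume R: ?R
    have "sat M (f(x := a)) V (foldr AllI xs p)" if a: "a \<in> indiv M" for a
      unfolding IH[OF a] using R by auto
    then show ?L by simp
  qed
qed

text \<open>Needed for extensionality: the formula only compares predicates on tuples
  \<open>map g xs\<close>, and distinctness of \<open>xs\<close> makes every tuple one of
  these.\<close>

lemma tuple_realised:
  assumes "distinct xs" "as \<in> tuples (indiv M) (length xs)" "\<forall>y. f y \<in> indiv M"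
  obtains g where "\<forall>y. g y \<in> indiv M" "\<forall>y. y \<notin> set xs \<longrightarrow> g y = f y" "map g xs = as"
proof -
  have "\<exists>g. (\<forall>y. g y \<in> indiv M) \<and> (\<forall>y. y \<notin> set xs \<longrightarrow> g y = f y) \<and> map g xs = as"
    using assms(1,2)
  proof (induction xs arbitrary: as)
    case Nil
    then show ?case using assms(3) by (auto simp: tuples_def)
  next
    case (Cons x xs)
    then obtain a bs where as: "as = a # bs" "a \<in> indiv M" "bs \<in> tuples (indiv M) (length xs)"
      by (cases as) (auto simp: tuples_def)
    with Cons obtain g where g: "\<forall>y. g y \<in> indiv M" "\<forall>y. y \<notin> set xs \<longrightarrow> g y = f y" "map g xs = bs"
      by fastforce
    show ?case
      by (rule exI[of _ "g(x := a)"]) (use g as Cons.prems in auto)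
  qed
  then show thesis using that by blast
qed

section \<open>Comprehension and extensionality in Henkin-Asser structures\<close>

lemma henkin_asser_structure_satisfies_comprehension:
  assumes M: "henkin_asser_structure M" and p: "p \<in> comprehension"
  shows "satisfies M p"
  unfolding satisfies_def
proof (intro allI impI)
  fix f V
  assume asg: "assignment M f V"
  from p obtain A xs H where p_eq: "p = ExP A (foldr AllI xs (Iff (Pred A xs) H))"
    and H: "wff H" "xs \<noteq> []" "distinct xs" "arity A = length xs" "A \<notin> free_pvars H"
    by (auto simp: comprehension_def)
  \<comment> \<open>Closure under definability supplies the witness of the existential predicate
    quantifier.\<close>
  define \<alpha> where "\<alpha> = defined_predicate M f V xs H"
  have f: "\<forall>y. f y \<in> indiv M" using asg by (simp add: assignment_def)
  have \<alpha>: "\<alpha> \<in> preds M (arity A)"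
    using M H asg unfolding henkin_asser_structure_def \<alpha>_def by auto
  have "sat M g (V(A := \<alpha>)) (Iff (Pred A xs) H)"
    if g: "\<forall>y. g y \<in> indiv M" "\<forall>y. y \<notin> set xs \<longrightarrow> g y = f y" for g
  proof -
    have 1: "sat M g (V(A := \<alpha>)) H = sat M g V H"
      by (rule sat_cong) (use H in auto)
    \<comment> \<open>An assignment that agrees with \<open>f\<close> off \<open>xs\<close> is
      determined by its values on \<open>xs\<close>. Hence membership of \<open>map g xs\<close> in
      \<open>\<alpha>\<close> can only be witnessed by \<open>g\<close> itself.\<close>
    have "g' = g" if "map g xs = map g' xs" "\<forall>y. y \<notin> set xs \<longrightarrow> g' y = f y" for g'
    proof
      fix y
      show "g' y = g y"
        using that g(2) by (cases "y \<in> set xs") auto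
    qed
    then have "map g xs \<in> \<alpha> \<longleftrightarrow> sat M g V H"
      unfolding \<alpha>_def defined_predicate_def using g by blast
    with 1 show ?thesis by simp
  qed
  then have "sat M f (V(A := \<alpha>)) (foldr AllI xs (Iff (Pred A xs) H))"
    unfolding sat_foldr_AllI[OF f] by blast
  with \<alpha> show "sat M f V p" unfolding p_eq by auto
qed

lemma predicate_structure_satisfies_extensionality:
  assumes M: "predicate_structure M" and p: "p \<in> extensionality"
  shows "satisfies M p"
  unfolding satisfies_def
proof (intro allI impI)
  fix f V
  assume asg: "assignment M f V"
  have f: "\<forall>y. f y \<in> indiv M" using asg by (simp add: assignment_def)
  from p obtain A B xs where
    p_eq: "p = AllP A (AllP B (Imp (foldr AllI xs (Iff (Pred A xs) (Pred B xs))) (PEq A B)))"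
    and xs: "xs \<noteq> []" "distinct xs" "arity A = length xs" "arity B = length xs"
    by (auto simp: extensionality_def)
  have sub: "\<gamma> \<subseteq> tuples (indiv M) (length xs)" if "\<gamma> \<in> preds M (length xs)" for \<gamma>
    using M that xs(1) by (cases xs) (auto simp: predicate_structure_def)
  show "sat M f V p"
    unfolding p_eq
  proof (simp del: fun_upd_apply, intro ballI impI)
    fix \<alpha> \<beta>
    assume ab: "\<alpha> \<in> preds M (arity A)" "\<beta> \<in> preds M (arity B)"
    \<comment> \<open>Working with the doubly updated assignment treats the case that
      \<open>A\<close> and \<open>B\<close> are the same variable together with the other
      one.\<close>
    define W where "W = V(A := \<alpha>, B := \<beta>)"
    assume "sat M f (V(A := \<alpha>, B := \<beta>)) (foldr AllI xs (Iff (Pred A xs) (Pred B xs)))"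
    then have eq: "map g xs \<in> W A \<longleftrightarrow> map g xs \<in> W B"
      if "\<forall>y. g y \<in> indiv M" "\<forall>y. y \<notin> set xs \<longrightarrow> g y = f y" for g
      using that unfolding sat_foldr_AllI[OF f] W_def by simp
    have W: "W A \<subseteq> tuples (indiv M) (length xs)" "W B \<subseteq> tuples (indiv M) (length xs)"
      using sub ab xs(3,4) unfolding W_def by auto
    have "as \<in> W A \<longleftrightarrow> as \<in> W B" if "as \<in> tuples (indiv M) (length xs)" for as
      using tuple_realised[OF xs(2) that f] eq by metis
    then have "W A = W B" using W by blast
    then show "(V(A := \<alpha>, B := \<beta>)) A = (V(A := \<alpha>, B := \<beta>)) B" unfolding W_def .
  qed
qed

lemma henkin_asser_structure_model_hax2:
  "henkin_asser_structure M \<Longrightarrow> model_of M hax2"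
  using henkin_asser_structure_satisfies_comprehension predicate_structure_satisfies_extensionality
  by (auto simp: model_of_def hax2_def henkin_asser_structure_def)


section \<open>Permutation models\<close>

text \<open>Finite members of \<open>\<I>\<close> support individual parameters, unions combine the
  supports of several parameters, and closure under images lets \<open>G\<close> act on the
  admissible predicates.\<close>

locale permutation_model =
  fixes G :: "('a \<Rightarrow> 'a) set" and \<I> :: "'a set set"
  assumes G_bij: "\<pi> \<in> G \<Longrightarrow> bij \<pi>"
    and G_comp: "\<pi> \<in> G \<Longrightarrow> \<sigma> \<in> G \<Longrightarrow> \<pi> \<circ> \<sigma> \<in> G"
    and G_inv: "\<pi> \<in> G \<Longrightarrow> inv \<pi> \<in> G"
    and ideal_finite: "finite P \<Longrightarrow> P \<in> \<I>"
    and ideal_Un: "P \<in> \<I> \<Longrightarrow> Q \<in> \<I> \<Longrightarrow> P \<union> Q \<in> \<I>"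
    and ideal_image: "\<pi> \<in> G \<Longrightarrow> P \<in> \<I> \<Longrightarrow> \<pi> ` P \<in> \<I>"
begin

abbreviation M :: "'a pstruct" where
  "M \<equiv> Sigma_struct UNIV G \<I>"

section \<open>Supports and the action of the group on predicates\<close>

definition supports :: "'a set \<Rightarrow> 'a list set \<Rightarrow> bool" where
  "supports P \<alpha> \<longleftrightarrow> (\<forall>\<pi>\<in>G. (\<forall>a\<in>P. \<pi> a = a) \<longrightarrow> map \<pi> ` \<alpha> = \<alpha>)"

lemma indiv_M [simp]: "indiv M = UNIV"
  by (simp add: Sigma_struct_def)

lemma preds_M: "\<alpha> \<in> preds M n \<longleftrightarrow> (\<forall>as\<in>\<alpha>. length as = n) \<and> (\<exists>P\<in>\<I>. supports P \<alpha>)"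
  by (auto simp: Sigma_struct_def tuples_def supports_def)

lemma G_inv_apply [simp]:
  assumes "\<pi> \<in> G"
  shows "inv \<pi> (\<pi> a) = a" "\<pi> (inv \<pi> a) = a"
  using G_bij[OF assms] by (simp_all add: bij_def surj_f_inv_f)

lemma G_map_inv [simp]:
  assumes "\<pi> \<in> G"
  shows "map (inv \<pi>) (map \<pi> as) = as" "map \<pi> (map (inv \<pi>) as) = as"
  using assms by (simp_all add: comp_def)

text \<open>One inclusion is enough, because the pointwise stabilizer of \<open>P\<close> is closed
  under inverses.\<close>

lemma supportsI:
  assumes "\<And>\<pi> as. \<pi> \<in> G \<Longrightarrow> (\<And>a. a \<in> P \<Longrightarrow> \<pi> a = a) \<Longrightarrow> as \<in> \<alpha> \<Longrightarrow> map \<pi> as \<in> \<alpha>"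
  shows "supports P \<alpha>"
  unfolding supports_def
proof (intro ballI impI)
  fix \<pi>
  assume \<pi>: "\<pi> \<in> G" "\<forall>a\<in>P. \<pi> a = a"
  have "inv \<pi> a = a" if "a \<in> P" for a
    using G_inv_apply(1)[OF \<pi>(1), of a] \<pi>(2) that by simp
  then have "map (inv \<pi>) as \<in> \<alpha>" if "as \<in> \<alpha>" for as
    using assms G_inv \<pi>(1) that by blast
  then have "as \<in> map \<pi> ` \<alpha>" if "as \<in> \<alpha>" for as
    using that G_map_inv(2)[OF \<pi>(1), of as] by (metis imageI)
  moreover have "map \<pi> ` \<alpha> \<subseteq> \<alpha>" using assms \<pi> by blast
  ultimately show "map \<pi> ` \<alpha> = \<alpha>" by blast
qed

lemma supportsD:
  "supports P \<alpha> \<Longrightarrow> \<pi> \<in> G \<Longrightarrow> (\<And>a. a \<in> P \<Longrightarrow> \<pi> a = a) \<Longrightarrow> map \<pi> ` \<alpha> = \<alpha>"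
  by (simp add: supports_def)

lemma supports_mono: "supports P \<alpha> \<Longrightarrow> P \<subseteq> Q \<Longrightarrow> supports Q \<alpha>"
  unfolding supports_def by (meson subsetD)

lemma supports_iff:
  assumes "supports P \<alpha>" "\<pi> \<in> G" "\<And>a. a \<in> P \<Longrightarrow> \<pi> a = a"
  shows "map \<pi> as \<in> \<alpha> \<longleftrightarrow> as \<in> \<alpha>"
proof -
  have "inj (map \<pi>)" using G_bij[OF assms(2)] by (simp add: bij_def)
  then have "map \<pi> as \<in> map \<pi> ` \<alpha> \<longleftrightarrow> as \<in> \<alpha>" by (rule inj_image_mem_iff)
  then show ?thesis using supportsD[OF assms] by simp
qed

text \<open>The image of a support supports the image: if \<open>\<sigma>\<close> fixes the image of
  \<open>P\<close> under \<open>\<pi>\<close> pointwise, then its conjugate by \<open>\<pi>\<close>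
  fixes \<open>P\<close> pointwise and so preserves \<open>\<alpha>\<close>.\<close>

lemma preds_image:
  assumes \<pi>: "\<pi> \<in> G" and \<alpha>: "\<alpha> \<in> preds M n"
  shows "map \<pi> ` \<alpha> \<in> preds M n"
proof -
  obtain P where P: "P \<in> \<I>" "supports P \<alpha>" using \<alpha> by (auto simp: preds_M)
  have "supports (\<pi> ` P) (map \<pi> ` \<alpha>)"
  proof (rule supportsI)
    fix \<sigma> as
    assume \<sigma>: "\<sigma> \<in> G" "\<And>a. a \<in> \<pi> ` P \<Longrightarrow> \<sigma> a = a" and "as \<in> map \<pi> ` \<alpha>"
    then obtain bs where bs: "bs \<in> \<alpha>" "as = map \<pi> bs" by blast
    let ?\<tau> = "inv \<pi> \<circ> (\<sigma> \<circ> \<pi>)"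
    have "map ?\<tau> bs \<in> \<alpha>"
      using supports_iff[OF P(2), of ?\<tau>] G_comp G_inv \<pi> \<sigma> bs(1) by simp
    moreover have "map \<sigma> as = map \<pi> (map ?\<tau> bs)"
      using \<pi> bs(2) by simp
    ultimately show "map \<sigma> as \<in> map \<pi> ` \<alpha>" by blast
  qed
  with P ideal_image[OF \<pi>] \<alpha> show ?thesis by (auto simp: preds_M)
qed

lemma preds_image_surj:
  assumes \<pi>: "\<pi> \<in> G" and \<alpha>: "\<alpha> \<in> preds M n"
  obtains \<beta> where "\<beta> \<in> preds M n" "\<alpha> = map \<pi> ` \<beta>"
proof
  show "map (inv \<pi>) ` \<alpha> \<in> preds M n" using preds_image G_inv assms by blast
  show "\<alpha> = map \<pi> ` map (inv \<pi>) ` \<alpha>"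
    unfolding image_image using G_map_inv(2)[OF \<pi>] by simp
qed

text \<open>Members of \<open>G\<close> are automorphisms of the structure. They permute the
  individuals and, by \<open>preds_image\<close> and \<open>preds_image_surj\<close>, each domain of
  predicates, so all quantifiers are respected.\<close>

lemma sat_permute:
  assumes \<pi>: "\<pi> \<in> G"
  shows "sat M (\<pi> \<circ> f) (\<lambda>A. map \<pi> ` V A) p = sat M f V p"
proof (induction p arbitrary: f V)
  case (Pred A xs)
  have "inj (map \<pi>)" using G_bij[OF \<pi>] by (simp add: bij_def)
  then have "map \<pi> (map f xs) \<in> map \<pi> ` V A \<longleftrightarrow> map f xs \<in> V A"
    by (rule inj_image_mem_iff)
  then show ?case by (simp only: sat.simps map_map)
next
  case (IEq x y)
  show ?case using G_bij[OF \<pi>] by (auto simp: bij_def dest: injD)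
next
  case (PEq A B)
  have "inj (map \<pi>)" using G_bij[OF \<pi>] by (simp add: bij_def)
  then show ?case by (simp add: inj_image_eq_iff)
next
  case (AllI x p)
  have IH: "sat M ((\<pi> \<circ> f)(x := \<pi> a)) (\<lambda>A. map \<pi> ` V A) p = sat M (f(x := a)) V p" for a
    unfolding fun_upd_comp[symmetric] by (rule AllI.IH)
  have "(\<forall>a. sat M ((\<pi> \<circ> f)(x := a)) (\<lambda>A. map \<pi> ` V A) p) \<longleftrightarrow>
        (\<forall>a. sat M ((\<pi> \<circ> f)(x := \<pi> a)) (\<lambda>A. map \<pi> ` V A) p)"
    using G_inv_apply(2)[OF \<pi>] by metis
  then show ?case using IH by (simp only: sat.simps indiv_M ball_UNIV bex_UNIV)
next
  case (ExI x p)
  have IH: "sat M ((\<pi> \<circ> f)(x := \<pi> a)) (\<lambda>A. map \<pi> ` V A) p = sat M (f(x := a)) V p" for a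
    unfolding fun_upd_comp[symmetric] by (rule ExI.IH)
  have "(\<exists>a. sat M ((\<pi> \<circ> f)(x := a)) (\<lambda>A. map \<pi> ` V A) p) \<longleftrightarrow>
        (\<exists>a. sat M ((\<pi> \<circ> f)(x := \<pi> a)) (\<lambda>A. map \<pi> ` V A) p)"
    using G_inv_apply(2)[OF \<pi>] by metis
  then show ?case using IH by (simp only: sat.simps indiv_M ball_UNIV bex_UNIV)
next
  case (AllP A p)
  have *: "(\<lambda>B. map \<pi> ` V B)(A := map \<pi> ` \<beta>) = (\<lambda>B. map \<pi> ` (V(A := \<beta>)) B)" for \<beta>
    by (rule ext) simp
  have "sat M (\<pi> \<circ> f) ((\<lambda>B. map \<pi> ` V B)(A := map \<pi> ` \<beta>)) p = sat M f (V(A := \<beta>)) p" for \<beta>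
    unfolding * by (rule AllP.IH)
  then show ?case
    unfolding sat.simps by (metis preds_image[OF \<pi>] preds_image_surj[OF \<pi>])
next
  case (ExP A p)
  have *: "(\<lambda>B. map \<pi> ` V B)(A := map \<pi> ` \<beta>) = (\<lambda>B. map \<pi> ` (V(A := \<beta>)) B)" for \<beta>
    by (rule ext) simp
  have "sat M (\<pi> \<circ> f) ((\<lambda>B. map \<pi> ` V B)(A := map \<pi> ` \<beta>)) p = sat M f (V(A := \<beta>)) p" for \<beta>
    unfolding * by (rule ExP.IH)
  then show ?case
    unfolding sat.simps by (metis preds_image[OF \<pi>] preds_image_surj[OF \<pi>])
qed auto

section \<open>Closure under second-order definability\<close>

lemma ideal_UN_finite: "finite K \<Longrightarrow> (\<And>k. k \<in> K \<Longrightarrow> P k \<in> \<I>) \<Longrightarrow> (\<Union>k\<in>K. P k) \<in> \<I>"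
  by (induction K rule: finite_induct) (auto intro: ideal_finite ideal_Un)

text \<open>Only finitely many parameters occur in \<open>H\<close>, so the values of its free
  individual variables and the supports of its free predicate variables have their union in
  \<open>\<I>\<close>.\<close>

lemma formula_support:
  assumes H: "wff H" and asg: "assignment M f V"
  obtains P where "P \<in> \<I>" "f ` free_ivars H \<subseteq> P" "\<forall>A\<in>free_pvars H. supports P (V A)"
proof -
  have "\<forall>A\<in>free_pvars H. \<exists>P\<in>\<I>. supports P (V A)"
    using asg wff_free_pvars_arity[OF H] by (auto simp: assignment_def preds_M)
  then obtain Q where Q: "\<And>A. A \<in> free_pvars H \<Longrightarrow> Q A \<in> \<I> \<and> supports (Q A) (V A)"
    by metis
  show thesis
  proof
    show "f ` free_ivars H \<union> (\<Union>A\<in>free_pvars H. Q A) \<in> \<I>"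
      using Q by (intro ideal_Un ideal_finite[OF finite_imageI[OF finite_free_ivars]]
          ideal_UN_finite[OF finite_free_pvars]) auto
  next
    show "\<forall>A\<in>free_pvars H. supports (f ` free_ivars H \<union> (\<Union>A\<in>free_pvars H. Q A)) (V A)"
    proof
      fix A
      assume A: "A \<in> free_pvars H"
      show "supports (f ` free_ivars H \<union> (\<Union>A\<in>free_pvars H. Q A)) (V A)"
        by (rule supports_mono[OF conjunct2[OF Q[OF A]]]) (use A in auto)
    qed
  qed auto
qed

lemma henkin_asser_structure_M: "henkin_asser_structure M"
  unfolding henkin_asser_structure_def
proof (intro conjI allI impI)
  have "{} \<in> preds M n" for n
    using ideal_finite[of "{}"] by (auto simp: preds_M supports_def)
  moreover have "\<alpha> \<subseteq> tuples (indiv M) n" if "\<alpha> \<in> preds M n" for \<alpha> n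
    using that by (auto simp: preds_M tuples_def)
  ultimately show "predicate_structure M"
    unfolding predicate_structure_def by (metis UNIV_not_empty empty_iff indiv_M)
next
  fix H and xs :: "nat list" and f :: "nat \<Rightarrow> 'a" and V
  assume "wff H \<and> xs \<noteq> [] \<and> distinct xs \<and> assignment M f V"
  then have H: "wff H" "distinct xs" "assignment M f V" by auto
  obtain P where P: "P \<in> \<I>" "f ` free_ivars H \<subseteq> P" "\<forall>A\<in>free_pvars H. supports P (V A)"
    using formula_support[OF H(1,3)] .
  have "supports P (defined_predicate M f V xs H)"
  proof (rule supportsI)
    fix \<pi> as
    assume \<pi>: "\<pi> \<in> G" "\<And>a. a \<in> P \<Longrightarrow> \<pi> a = a" and "as \<in> defined_predicate M f V xs H"
    then obtain g where g: "as = map g xs" "\<forall>y. y \<notin> set xs \<longrightarrow> g y = f y" "sat M g V H"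
      by (auto simp: defined_predicate_def)
    \<comment> \<open>\<open>defined_predicate\<close> demands agreement with \<open>f\<close> off
      \<open>xs\<close>, which \<open>\<pi> \<circ> g\<close> may violate. On the free variables of
      \<open>H\<close> the two coincide, since \<open>f\<close> takes values in \<open>P\<close>
      there and \<open>\<pi>\<close> fixes \<open>P\<close>.\<close>
    define h where "h y = (if y \<in> set xs then \<pi> (g y) else f y)" for y
    have "sat M h V H = sat M (\<pi> \<circ> g) (\<lambda>A. map \<pi> ` V A) H"
      by (rule sat_cong) (use P \<pi> g(2) in \<open>auto simp: h_def supports_def\<close>)
    then have "sat M h V H" using sat_permute[OF \<pi>(1)] g(3) by simp
    moreover have "map \<pi> as = map h xs" "\<forall>y. y \<notin> set xs \<longrightarrow> h y = f y"
      using g(1) by (simp_all add: h_def)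
    ultimately show "map \<pi> as \<in> defined_predicate M f V xs H"
      unfolding defined_predicate_def indiv_M by blast
  qed
  with P(1) show "defined_predicate M f V xs H \<in> preds M (length xs)"
    by (auto simp: preds_M defined_predicate_def)
qed

end


section \<open>Block models\<close>

definition block_group :: "('a \<Rightarrow> 'b) \<Rightarrow> ('a \<Rightarrow> 'a) set" where
  "block_group b = {\<pi>. bij \<pi> \<and> (\<forall>a. b (\<pi> a) = b a)}"

definition block_ideal :: "('a \<Rightarrow> 'b) \<Rightarrow> 'a set set" where
  "block_ideal b = {P. \<exists>k. \<forall>n. finite {a \<in> P. b a = n} \<and> card {a \<in> P. b a = n} \<le> k}"

lemma block_idealI:
  assumes "\<And>n. finite {a \<in> P. b a = n}" "\<And>n. card {a \<in> P. b a = n} \<le> k"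
  shows "P \<in> block_ideal b"
  using assms unfolding block_ideal_def by blast

lemma permutation_model_block: "permutation_model (block_group b) (block_ideal b)"
proof
  fix \<pi> assume \<pi>: "\<pi> \<in> block_group b"
  then show "bij \<pi>" by (simp add: block_group_def)
  then have "\<pi> (inv \<pi> a) = a" for a by (simp add: bij_def surj_f_inv_f)
  then have "b (inv \<pi> a) = b a" for a
    using \<pi> unfolding block_group_def by (metis (mono_tags, lifting) mem_Collect_eq)
  with \<open>bij \<pi>\<close> show "inv \<pi> \<in> block_group b" by (simp add: block_group_def bij_imp_bij_inv)
next
  fix \<pi> \<sigma> assume "\<pi> \<in> block_group b" "\<sigma> \<in> block_group b"
  then show "\<pi> \<circ> \<sigma> \<in> block_group b" by (auto simp: block_group_def intro: bij_comp)
next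
  fix P :: "'a set" assume "finite P"
  then show "P \<in> block_ideal b" by (intro block_idealI[of _ _ "card P"]) (auto intro: card_mono)
next
  fix P Q assume "P \<in> block_ideal b" "Q \<in> block_ideal b"
  then obtain k l where k: "\<And>n. finite {a \<in> P. b a = n}" "\<And>n. card {a \<in> P. b a = n} \<le> k"
    and l: "\<And>n. finite {a \<in> Q. b a = n}" "\<And>n. card {a \<in> Q. b a = n} \<le> l"
    by (auto simp: block_ideal_def)
  have *: "{a \<in> P \<union> Q. b a = n} = {a \<in> P. b a = n} \<union> {a \<in> Q. b a = n}" for n by auto
  show "P \<union> Q \<in> block_ideal b"
  proof (rule block_idealI)
    fix n
    show "finite {a \<in> P \<union> Q. b a = n}" unfolding * using k l by simp
    show "card {a \<in> P \<union> Q. b a = n} \<le> k + l"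
      unfolding * by (rule order_trans[OF card_Un_le add_mono[OF k(2) l(2)]])
  qed
next
  fix \<pi> P assume \<pi>: "\<pi> \<in> block_group b" and "P \<in> block_ideal b"
  then obtain k where k: "\<And>n. finite {a \<in> P. b a = n}" "\<And>n. card {a \<in> P. b a = n} \<le> k"
    by (auto simp: block_ideal_def)
  \<comment> \<open>\<open>\<pi>\<close> acts inside each block, so the bound \<open>k\<close>
    carries over to the image.\<close>
  have *: "{a \<in> \<pi> ` P. b a = n} = \<pi> ` {a \<in> P. b a = n}" for n
    using \<pi> by (auto simp: block_group_def)
  show "\<pi> ` P \<in> block_ideal b"
    by (rule block_idealI[of _ _ k]; unfold *)
      (use k in \<open>auto intro: order_trans[OF card_image_le]\<close>)
qed

locale block_model =
  fixes b :: "nat \<Rightarrow> nat"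
begin

sublocale permutation_model "block_group b" "block_ideal b"
  by (rule permutation_model_block)

section \<open>Uniformization of binary predicates\<close>

lemma transpose_block_group: "b y = b z \<Longrightarrow> transpose y z \<in> block_group b"
  by (auto simp: block_group_def transpose_def)

text \<open>Two points per block are added outside \<open>P\<close> where available, so that one
  remains if the other happens to be \<open>a\<close>.\<close>

lemma enlarge_support:
  assumes P: "P \<in> block_ideal b"
  obtains P' where "P' \<in> block_ideal b" "P \<subseteq> P'"
    "\<And>y a. y \<notin> P \<Longrightarrow> y \<noteq> a \<Longrightarrow> \<exists>z\<in>P'. z \<notin> P \<and> z \<noteq> a \<and> b z = b y"
proof -
  define c where "c n = (SOME y. b y = n \<and> y \<notin> P)" for n
  define d where "d n = (SOME y. b y = n \<and> y \<notin> P \<and> y \<noteq> c n)" for n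
  \<comment> \<open>Testing \<open>y\<close> against \<open>c\<close> and \<open>d\<close> at its
    own block keeps \<open>Q\<close> within two points per block, even where \<open>SOME\<close> has
    no witness and may return a point of another block.\<close>
  define Q where "Q = {y. y = c (b y) \<or> y = d (b y)}"
  have sub: "{a \<in> Q. b a = n} \<subseteq> {c n, d n}" for n by (auto simp: Q_def)
  have "Q \<in> block_ideal b"
  proof (rule block_idealI)
    fix n
    show "finite {a \<in> Q. b a = n}" using sub by (rule finite_subset) simp
    have "card {a \<in> Q. b a = n} \<le> card {c n, d n}" using sub by (intro card_mono) auto
    also have "\<dots> \<le> 2" by (simp add: card_insert_if)
    finally show "card {a \<in> Q. b a = n} \<le> 2" .
  qed
  then have "P \<union> Q \<in> block_ideal b" using P ideal_Un by blast
  moreover have "\<exists>z\<in>P \<union> Q. z \<notin> P \<and> z \<noteq> a \<and> b z = b y" if y: "y \<notin> P" "y \<noteq> a" for y a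
  proof -
    have c: "b (c (b y)) = b y \<and> c (b y) \<notin> P"
      unfolding c_def by (rule someI[of _ y]) (use y in auto)
    show ?thesis
    proof (cases "c (b y) = a")
      case True
      have "b (d (b y)) = b y \<and> d (b y) \<notin> P \<and> d (b y) \<noteq> c (b y)"
        unfolding d_def by (rule someI[of _ y]) (use y True in auto)
      then show ?thesis using True by (intro bexI[of _ "d (b y)"]) (auto simp: Q_def)
    next
      case False
      then show ?thesis using c by (intro bexI[of _ "c (b y)"]) (auto simp: Q_def)
    qed
  qed
  ultimately show thesis using that by blast
qed

text \<open>The natural order is not invariant under the group, but on \<open>P'\<close> it may be
  used freely, because permutations fixing \<open>P'\<close> pointwise do not move the
  candidates.\<close>

lemma uniformization:
  assumes R: "R \<in> preds M 2"
  shows "\<exists>S\<in>preds M 2. \<forall>a. (\<exists>y. [a, y] \<in> R) \<longrightarrow> (\<exists>z. \<forall>y. [a, y] \<in> R \<and> [a, y] \<in> S \<longleftrightarrow> y = z)"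
proof -
  obtain P where P: "P \<in> block_ideal b" "supports P R" using R by (auto simp: preds_M)
  obtain P' where P': "P' \<in> block_ideal b" "P \<subseteq> P'"
    and fresh: "\<And>y a. y \<notin> P \<Longrightarrow> y \<noteq> a \<Longrightarrow> \<exists>z\<in>P'. z \<notin> P \<and> z \<noteq> a \<and> b z = b y"
    using enlarge_support[OF P(1)] by blast
  \<comment> \<open>The section at \<open>a\<close> may miss \<open>P'\<close> altogether, but by
    \<open>meets\<close> below a nonempty one does so only if it contains \<open>a\<close>; then
    \<open>a\<close> is an equivariant choice.\<close>
  define c where "c a = (if [a, a] \<in> R then a else LEAST y. y \<in> P' \<and> [a, y] \<in> R)" for a
  have meets: "\<exists>z\<in>P'. [a, z] \<in> R" if "[a, a] \<notin> R" "[a, y] \<in> R" for a y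
  proof (cases "y \<in> P")
    case True
    then show ?thesis using that P' by blast
  next
    case False
    have "y \<noteq> a" using that by auto
    with False fresh obtain z where z: "z \<in> P'" "z \<notin> P" "z \<noteq> a" "b z = b y" by metis
    \<comment> \<open>This transposition stays in one block and fixes both \<open>P\<close> and
      \<open>a\<close>, so it preserves \<open>R\<close> and replaces \<open>y\<close> by a point of
      \<open>P'\<close>.\<close>
    have "map (transpose y z) [a, y] \<in> R"
      using supports_iff[OF P(2) transpose_block_group[of y z], of "[a, y]"] that z False
      by (metis transpose_apply_other)
    then show ?thesis using z \<open>y \<noteq> a\<close> by auto
  qed
  have c: "[a, c a] \<in> R" if "[a, y] \<in> R" for a y
  proof (cases "[a, a] \<in> R")
    case False
    then show ?thesis
      using meets[OF False that] LeastI_ex[of "\<lambda>y. y \<in> P' \<and> [a, y] \<in> R"] by (auto simp: c_def)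
  qed (simp add: c_def)
  define S where "S = {[a, c a] | a. [a, c a] \<in> R}"
  have "supports P' S"
  proof (rule supportsI)
    fix \<pi> as
    assume \<pi>: "\<pi> \<in> block_group b" "\<And>a. a \<in> P' \<Longrightarrow> \<pi> a = a" and "as \<in> S"
    then obtain a where a: "as = [a, c a]" "[a, c a] \<in> R" by (auto simp: S_def)
    have R\<pi>: "[\<pi> u, \<pi> v] \<in> R \<longleftrightarrow> [u, v] \<in> R" for u v
      using supports_iff[OF P(2) \<pi>(1), of "[u, v]"] \<pi>(2) P'(2) by auto
    have "c (\<pi> a) = \<pi> (c a)"
    proof (cases "[a, a] \<in> R")
      case True
      then show ?thesis using R\<pi> by (simp add: c_def)
    next
      case False
      then have "\<exists>y. y \<in> P' \<and> [a, y] \<in> R" using meets a(2) by blast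
      from LeastI_ex[OF this] have "c a \<in> P'" using False by (simp add: c_def)
      \<comment> \<open>The sections at \<open>a\<close> and \<open>\<pi> a\<close> have the same
        part in \<open>P'\<close>, hence the same least element there, and \<open>\<pi>\<close>
        fixes it.\<close>
      moreover have "(y \<in> P' \<and> [\<pi> a, y] \<in> R) = (y \<in> P' \<and> [a, y] \<in> R)" for y
        using R\<pi>[of a y] \<pi>(2) by auto
      then have "c (\<pi> a) = c a" using False R\<pi> by (simp add: c_def)
      ultimately show ?thesis using \<pi>(2) by simp
    qed
    then show "map \<pi> as \<in> S" using a R\<pi>[of a "c a"] by (auto simp: S_def)
  qed
  with P' have "S \<in> preds M 2" by (auto simp: preds_M S_def)
  moreover have "[a, y] \<in> R \<and> [a, y] \<in> S \<longleftrightarrow> y = c a" if "[a, u] \<in> R" for a u y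
    using c[OF that] by (auto simp: S_def)
  ultimately show ?thesis by blast
qed

lemma satisfies_AC11: "satisfies M AC11"
  unfolding satisfies_def
proof (intro allI impI)
  fix f V
  let ?p = "Imp (AllI 0 (Iff (Pred (PV 1 0) [0]) (ExI 1 (Pred (PV 2 0) [0, 1]))))
               (AllI 0 (Imp (Pred (PV 1 0) [0])
                 (Ex1I 2 1 (Conj (Pred (PV 2 0) [0, 1]) (Pred (PV 2 1) [0, 1])))))"
  have "\<exists>S\<in>preds M 2. sat M f (V(PV 1 0 := A, PV 2 0 := R, PV 2 1 := S)) ?p"
    if R: "R \<in> preds M 2" for A R
  proof -
    obtain S where S: "S \<in> preds M 2"
      "\<And>a. \<exists>y. [a, y] \<in> R \<Longrightarrow> \<exists>z. \<forall>y. [a, y] \<in> R \<and> [a, y] \<in> S \<longleftrightarrow> y = z"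
      using uniformization[OF R] by blast
    show ?thesis
      by (rule bexI[OF _ S(1)]) (use S(2) in \<open>simp add: Ex1I_def\<close>)
  qed
  then show "sat M f V AC11"
    unfolding AC11_def Let_def by simp
qed

lemma model_hax2_AC11: "model_of M (hax2 \<union> {AC11})"
  using henkin_asser_structure_model_hax2[OF henkin_asser_structure_M] satisfies_AC11
  by (auto simp: model_of_def)

end


section \<open>The basic Fraenkel model\<close>

interpretation Fraenkel: block_model "\<lambda>_. 0" .

lemma block_group_const: "block_group (\<lambda>_. c) = {\<pi>. bij \<pi>}"
  by (simp add: block_group_def)

lemma block_ideal_const: "block_ideal (\<lambda>_ :: 'a. c) = {P. finite P}"
proof -
  have eq: "{a \<in> P. c = n} = (if c = n then P else {})" for P :: "'a set" and n by auto
  show ?thesis unfolding block_ideal_def eq by auto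
qed

lemma Sigma0_eq: "Sigma0 = Fraenkel.M"
  by (simp add: Sigma0_def block_group_const block_ideal_const)

lemma preds_Sigma0:
  "\<alpha> \<in> preds Sigma0 n \<longleftrightarrow>
    (\<forall>as\<in>\<alpha>. length as = n) \<and> (\<exists>P. finite P \<and> Fraenkel.supports P \<alpha>)"
  unfolding Sigma0_eq Fraenkel.preds_M by (simp add: block_ideal_const Bex_def)

text \<open>
  Outside a finite set, the choice at one point \<open>x0\<close> is transported to \<open>a\<close> by the transposition of
  \<open>x0\<close> and \<open>a\<close>; the finitely many remaining choices are arbitrary.
\<close>

lemma Sigma0_choice:
  fixes \<Phi> :: "nat \<Rightarrow> nat list set \<Rightarrow> bool"
  assumes P: "finite P"
    and inv: "\<And>\<pi> a \<alpha>. bij \<pi> \<Longrightarrow> (\<And>c. c \<in> P \<Longrightarrow> \<pi> c = c) \<Longrightarrow> \<Phi> a \<alpha> \<Longrightarrow> \<Phi> (\<pi> a) (map \<pi> ` \<alpha>)"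
    and ex: "\<And>a. \<exists>\<alpha>\<in>preds Sigma0 1. \<Phi> a \<alpha>"
  obtains S D where "S \<in> preds Sigma0 2" "\<And>a. D a \<in> preds Sigma0 1" "\<And>a. \<Phi> a (D a)"
    "\<And>a y. [a, y] \<in> S \<longleftrightarrow> [y] \<in> D a"
proof -
  have G: "\<pi> \<in> block_group (\<lambda>_. 0 :: nat) \<longleftrightarrow> bij \<pi>" for \<pi> :: "nat \<Rightarrow> nat"
    by (simp add: block_group_const)
  obtain g where g: "\<And>a. g a \<in> preds Sigma0 1" "\<And>a. \<Phi> a (g a)"
    using ex by metis
  have "\<exists>Q. finite Q \<and> Fraenkel.supports Q (g a)" for a
    using g(1)[of a] unfolding preds_Sigma0 by blast
  then obtain Q where Q: "\<And>a. finite (Q a)" "\<And>a. Fraenkel.supports (Q a) (g a)"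
    by metis
  obtain x0 where x0: "x0 \<notin> P" using P ex_new_if_finite infinite_UNIV_nat by blast
  \<comment> \<open>Since \<open>C\<close> contains \<open>P\<close>, for \<open>a\<close> outside
    \<open>C\<close> the transposition of \<open>x0\<close> and \<open>a\<close> fixes
    \<open>P\<close> pointwise, so \<open>inv\<close> turns the choice at \<open>x0\<close> into one
    at \<open>a\<close>.\<close>
  define C where "C = P \<union> Q x0 - {x0}"
  define D where "D a = (if a \<in> C then g a else map (transpose x0 a) ` g x0)" for a
  define S where "S = {[a, y] | a y. [y] \<in> D a}"
  \<comment> \<open>Fixing \<open>x0\<close> and \<open>Q x0\<close> makes the transported choices
    equivariant; fixing \<open>C\<close> and the sets \<open>Q a\<close> preserves the finitely many
    exceptional ones.\<close>
  define T where "T = insert x0 (C \<union> Q x0 \<union> (\<Union>a\<in>C. Q a))"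
  have D1: "D a \<in> preds Sigma0 1" for a
    using g(1) Fraenkel.preds_image[of "transpose x0 a" "g x0" 1]
    by (simp add: D_def Sigma0_eq G)
  have D2: "\<Phi> a (D a)" for a
  proof (cases "a \<in> C")
    case True
    then show ?thesis using g by (simp add: D_def)
  next
    case False
    have "transpose x0 a c = c" if "c \<in> P" for c
      using that x0 False by (auto simp: C_def transpose_def)
    then have "\<Phi> (transpose x0 a x0) (map (transpose x0 a) ` g x0)"
      using inv g(2) by (metis bij_transpose)
    then show ?thesis using False by (simp add: D_def)
  qed
  have "Fraenkel.supports T S"
  proof (rule Fraenkel.supportsI)
    fix \<pi> as
    assume "\<pi> \<in> block_group (\<lambda>_. 0 :: nat)" and fix_T: "\<And>c. c \<in> T \<Longrightarrow> \<pi> c = c" and "as \<in> S"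
    then have \<pi>: "bij \<pi>" and \<pi>G: "\<pi> \<in> block_group (\<lambda>_. 0 :: nat)" by (auto simp: G)
    obtain a y where as: "as = [a, y]" "[y] \<in> D a" using \<open>as \<in> S\<close> by (auto simp: S_def)
    have "map \<pi> ` D a = D (\<pi> a)"
    proof (cases "a \<in> C")
      case True
      then have "\<pi> a = a" using fix_T by (simp add: T_def)
      moreover have "map \<pi> ` g a = g a"
        by (rule Fraenkel.supportsD[OF Q(2) \<pi>G]) (use True fix_T in \<open>auto simp: T_def\<close>)
      ultimately show ?thesis using True by (simp add: D_def)
    next
      case False
      \<comment> \<open>An injective map that fixes \<open>C\<close> pointwise cannot send an
        outside point into \<open>C\<close>.\<close>
      have "\<pi> a \<notin> C"
      proof
        assume "\<pi> a \<in> C"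
        then have "\<pi> (\<pi> a) = \<pi> a" using fix_T by (simp add: T_def)
        then have "\<pi> a = a" using \<pi> by (simp add: bij_def inj_eq)
        with \<open>\<pi> a \<in> C\<close> False show False by simp
      qed
      have "\<pi> x0 = x0" using fix_T by (simp add: T_def)
      \<comment> \<open>Conjugating the transposition of \<open>x0\<close> and \<open>a\<close> by
        \<open>\<pi>\<close> gives that of \<open>\<pi> x0\<close> and \<open>\<pi> a\<close>, and
        \<open>x0\<close> is fixed.\<close>
      then have "\<pi> \<circ> transpose x0 a = transpose x0 (\<pi> a) \<circ> \<pi>"
        using \<pi> by (auto simp: fun_eq_iff transpose_def bij_def inj_eq)
      then have "map \<pi> ` map (transpose x0 a) ` g x0 = map (transpose x0 (\<pi> a)) ` map \<pi> ` g x0"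
        by (simp add: image_image)
      also have "map \<pi> ` g x0 = g x0"
        by (rule Fraenkel.supportsD[OF Q(2) \<pi>G]) (use fix_T in \<open>auto simp: T_def\<close>)
      finally show ?thesis using False \<open>\<pi> a \<notin> C\<close> by (simp add: D_def)
    qed
    then have "[\<pi> y] \<in> D (\<pi> a)" using imageI[OF as(2), of "map \<pi>"] by simp
    then show "map \<pi> as \<in> S" using as(1) by (simp add: S_def)
  qed
  moreover have "finite T" using P Q(1) by (simp add: T_def C_def)
  ultimately have "S \<in> preds Sigma0 2"
    unfolding preds_Sigma0 by (auto simp: S_def)
  then show thesis using that[of S D] D1 D2 by (simp add: S_def)
qed

text \<open>Satisfaction of \<open>H\<close> by a pair \<open>a\<close>, \<open>\<alpha>\<close> is
  invariant under the permutations that fix a support of the parameters, which is what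
  \<open>Sigma0_choice\<close> requires.\<close>

lemma Sigma0_satisfies_choice_h:
  assumes vars: "choice_vars x y D S H"
  shows "satisfies Sigma0 (choice_h x y D S H)"
  unfolding satisfies_def
proof (intro allI impI)
  fix f V
  assume asg: "assignment Sigma0 f V"
  have H: "wff H" "arity D = 1" "arity S = 2" "x \<noteq> y" "S \<notin> free_pvars H"
    using vars by (auto simp: choice_vars_def)
  obtain P where P: "P \<in> block_ideal (\<lambda>_. 0 :: nat)" "f ` free_ivars H \<subseteq> P"
    "\<forall>A\<in>free_pvars H. Fraenkel.supports P (V A)"
    using Fraenkel.formula_support[OF H(1) asg[unfolded Sigma0_eq]] .
  define \<Phi> where "\<Phi> a \<alpha> \<longleftrightarrow> sat Sigma0 (f(x := a)) (V(D := \<alpha>)) H" for a \<alpha>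
  have inv: "\<Phi> (\<pi> a) (map \<pi> ` \<alpha>)"
    if \<pi>: "bij \<pi>" "\<And>c. c \<in> P \<Longrightarrow> \<pi> c = c" and "\<Phi> a \<alpha>" for \<pi> a \<alpha>
  proof -
    have \<pi>G: "\<pi> \<in> block_group (\<lambda>_. 0 :: nat)" using \<pi> by (simp add: block_group_const)
    \<comment> \<open>All free variables of \<open>H\<close> other than \<open>x\<close> and
      \<open>D\<close> have values fixed by \<open>\<pi>\<close>, so updating these two amounts to
      permuting the whole assignment.\<close>
    have "sat Sigma0 (f(x := \<pi> a)) (V(D := map \<pi> ` \<alpha>)) H =
      sat Sigma0 (\<pi> \<circ> f(x := a)) (\<lambda>A. map \<pi> ` (V(D := \<alpha>)) A) H"
      by (rule sat_cong) (use P \<pi> \<pi>G in \<open>auto simp: Fraenkel.supports_def\<close>)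
    then show ?thesis
      using \<open>\<Phi> a \<alpha>\<close> Fraenkel.sat_permute[OF \<pi>G] unfolding \<Phi>_def Sigma0_eq by (simp only:)
  qed
  have UNIV: "indiv Sigma0 = UNIV" by (simp add: Sigma0_eq)
  show "sat Sigma0 f V (choice_h x y D S H)"
    unfolding choice_h_def sat.simps(7)
  proof
    assume "sat Sigma0 f V (AllI x (ExP D H))"
    then have ex: "\<exists>\<alpha>\<in>preds Sigma0 1. \<Phi> a \<alpha>" for a
      by (simp add: \<Phi>_def H UNIV)
    have fin: "finite P" using P(1) by (simp add: block_ideal_const)
    obtain s d where sd: "s \<in> preds Sigma0 2" "\<And>a. d a \<in> preds Sigma0 1" "\<And>a. \<Phi> a (d a)"
      "\<And>a y. [a, y] \<in> s \<longleftrightarrow> [y] \<in> d a"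
      using Sigma0_choice[of P \<Phi>, OF fin inv ex] by blast
    have "sat Sigma0 (f(x := a)) (V(S := s, D := d a)) H = \<Phi> a (d a)" for a
      unfolding \<Phi>_def by (rule sat_cong) (use H in auto)
    moreover have "S \<noteq> D" using H by auto
    ultimately have "sat Sigma0 (f(x := a)) (V(S := s, D := d a))
        (Conj (AllI y (Iff (Pred D [y]) (Pred S [x, y]))) H)" for a
      using sd(3,4) H(4) by simp
    then show "sat Sigma0 f V
        (ExP S (AllI x (ExP D (Conj (AllI y (Iff (Pred D [y]) (Pred S [x, y]))) H))))"
      unfolding sat.simps(9,12) H(2,3) using sd(1,2) by blast
  qed
qed


section \<open>A block model without Ackermann choice\<close>

text \<open>Block \<open>n\<close> is the interval from \<open>2 * n^2\<close> up to but excluding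
  \<open>2 * (n + 1)^2\<close>, with \<open>4 * n + 2\<close> elements. Halving the argument first
  keeps \<open>2 * m\<close> and \<open>2 * m + 1\<close> together.\<close>

definition blk :: "nat \<Rightarrow> nat" where
  "blk a = floor_sqrt (a div 2)"

interpretation Halving: block_model blk .

lemma finite_block: "finite {a. blk a = n}"
proof -
  have "a \<le> 2 * (Suc n)\<^sup>2 + 1" if "blk a = n" for a
  proof -
    have "a div 2 < (Suc n)\<^sup>2"
      using Suc_floor_sqrt_power2_gt[of "a div 2"] that by (simp add: blk_def)
    then show ?thesis by linarith
  qed
  then have "{a. blk a = n} \<subseteq> {..2 * (Suc n)\<^sup>2 + 1}" by auto
  then show ?thesis by (rule finite_subset) simp
qed

text \<open>The first \<open>2 * n + 1\<close> elements of the block suffice: the bound is compared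
  with two halves of at most \<open>n\<close> points each.\<close>

lemma card_block: "2 * n < card {a. blk a = n}"
proof -
  have "blk a = n" if "a \<in> {2 * n\<^sup>2..2 * n\<^sup>2 + 2 * n}" for a
    unfolding blk_def
    by (rule floor_sqrt_unique) (use that in \<open>auto simp: power2_eq_square\<close>)
  then have "card {2 * n\<^sup>2..2 * n\<^sup>2 + 2 * n} \<le> card {a. blk a = n}"
    by (intro card_mono finite_block) auto
  then show ?thesis by simp
qed

definition same_block :: "nat list set" where
  "same_block = {[a, c] | a c. blk a = blk c}"

text \<open>
  With \<open>PV 2 0\<close> interpreted as \<open>same_block\<close>, \<open>halving\<close> says that \<open>PV 2 2\<close> matches the
  elements of \<open>D = PV 1 0\<close> in the block of \<open>x\<^sub>0\<close> with the other elements of the block.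
\<close>

definition halving :: fm where
  "halving = ExP (PV 2 2) (Conj
     (AllI 1 (AllI 2 (AllI 3
       (Imp (Conj (Pred (PV 2 2) [1, 2]) (Pred (PV 2 2) [1, 3])) (IEq 2 3)))))
     (AllI 1 (Imp (Pred (PV 2 0) [0, 1]) (ExI 2 (Conj (Pred (PV 2 0) [0, 2])
       (Conj (Conj (Pred (PV 2 2) [1, 2]) (Pred (PV 2 2) [2, 1]))
         (Iff (Pred (PV 1 0) [1]) (Neg (Pred (PV 1 0) [2])))))))))"

lemma choice_vars_halving: "choice_vars 0 1 (PV 1 0) (PV 2 1) halving"
  by (simp add: choice_vars_def halving_def)

lemma sat_halving:
  assumes "V (PV 2 0) = same_block"
  shows "sat Halving.M f V halving \<longleftrightarrow>
    (\<exists>F\<in>preds Halving.M 2. (\<forall>u v w. [u, v] \<in> F \<and> [u, w] \<in> F \<longrightarrow> v = w) \<and>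
      (\<forall>u. blk (f 0) = blk u \<longrightarrow> (\<exists>v. blk (f 0) = blk v \<and> [u, v] \<in> F \<and> [v, u] \<in> F \<and>
         ([u] \<in> V (PV 1 0) \<longleftrightarrow> [v] \<notin> V (PV 1 0)))))"
  unfolding halving_def using assms by (simp add: same_block_def)

section \<open>Admissible halvings of single blocks\<close>

lemma finite_pred_in_Halving:
  assumes "finite P" "\<And>as. as \<in> \<alpha> \<Longrightarrow> length as = n \<and> set as \<subseteq> P"
  shows "\<alpha> \<in> preds Halving.M n"
proof -
  have "Halving.supports P \<alpha>"
  proof (rule Halving.supportsI)
    fix \<pi> as
    assume \<pi>: "\<And>a. a \<in> P \<Longrightarrow> \<pi> a = a" and as: "as \<in> \<alpha>"
    have "map \<pi> as = as" by (rule map_idI) (use \<pi> assms(2)[OF as] in auto)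
    then show "map \<pi> as \<in> \<alpha>" using as by simp
  qed
  then show ?thesis
    using assms Halving.ideal_finite by (auto simp: Halving.preds_M)
qed

lemma same_block_in_Halving: "same_block \<in> preds Halving.M 2"
proof -
  have "Halving.supports {} same_block"
    by (rule Halving.supportsI) (auto simp: block_group_def same_block_def)
  then show ?thesis
    using Halving.ideal_finite[of "{}"] by (auto simp: Halving.preds_M same_block_def)
qed

text \<open>The block splits into pairs of an even number and its successor. Its even members and
  the matching \<open>s\<close> that swaps each pair live on a finite set, so both are
  admissible.\<close>

lemma blocks_halvable:
  assumes V: "V (PV 2 0) = same_block"
  shows "\<exists>\<alpha>\<in>preds Halving.M 1. sat Halving.M f (V(PV 1 0 := \<alpha>)) halving"
proof -
  define B where "B = {a. blk a = blk (f 0)}"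
  define s where "s a = (if even a then a + 1 else a - 1)" for a :: nat
  have s: "blk (s a) = blk a" "s (s a) = a" "even (s a) \<longleftrightarrow> odd a" for a
    by (auto simp: s_def blk_def elim!: oddE evenE)
  define \<alpha> where "\<alpha> = {[a] | a. a \<in> B \<and> even a}"
  define F where "F = {[a, s a] | a. a \<in> B}"
  have B: "finite B" unfolding B_def by (rule finite_block)
  have sB: "s a \<in> B \<longleftrightarrow> a \<in> B" for a using s(1) by (simp add: B_def)
  have "\<alpha> \<in> preds Halving.M 1"
    by (rule finite_pred_in_Halving[OF B]) (auto simp: \<alpha>_def)
  moreover have F: "F \<in> preds Halving.M 2"
    by (rule finite_pred_in_Halving[OF B]) (auto simp: F_def sB)
  moreover have "sat Halving.M f (V(PV 1 0 := \<alpha>)) halving"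
  proof -
    have V': "(V(PV 1 0 := \<alpha>)) (PV 2 0) = same_block" using V by simp
    have "\<exists>v. blk (f 0) = blk v \<and> [u, v] \<in> F \<and> [v, u] \<in> F \<and> ([u] \<in> \<alpha> \<longleftrightarrow> [v] \<notin> \<alpha>)"
      if "blk (f 0) = blk u" for u
      by (rule exI[of _ "s u"]) (use that s in \<open>auto simp: F_def \<alpha>_def B_def\<close>)
    moreover have "\<forall>u v w. [u, v] \<in> F \<and> [u, w] \<in> F \<longrightarrow> v = w" by (auto simp: F_def)
    ultimately show ?thesis
      unfolding sat_halving[of "V(PV 1 0 := \<alpha>)", OF V'] fun_upd_same
      by (intro bexI[OF _ F] conjI) auto
  qed
  ultimately show ?thesis by blast
qed

section \<open>No admissible binary predicate halves all blocks\<close>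

lemma card_le_of_matching:
  assumes "finite Y" and F: "\<And>u v w. [u, v] \<in> F \<Longrightarrow> [u, w] \<in> F \<Longrightarrow> v = w"
    and match: "\<And>u. u \<in> X \<Longrightarrow> \<exists>v\<in>Y. [v, u] \<in> F"
  shows "card X \<le> card Y"
proof -
  obtain m where m: "\<And>u. u \<in> X \<Longrightarrow> m u \<in> Y \<and> [m u, u] \<in> F" using match by metis
  \<comment> \<open>If two points had the same partner in \<open>Y\<close>, functionality of
    \<open>F\<close> at that partner would identify them.\<close>
  then have "inj_on m X" by (metis F inj_onI)
  then show ?thesis using m assms(1) by (intro card_inj_on_le[of m]) auto
qed

lemma Halving_not_satisfies_choice_h:
  "\<not> satisfies Halving.M (choice_h 0 1 (PV 1 0) (PV 2 1) halving)"
proof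
  assume sat: "satisfies Halving.M (choice_h 0 1 (PV 1 0) (PV 2 1) halving)"
  \<comment> \<open>The failing assignment: the parameter of \<open>halving\<close> is
    \<open>same_block\<close>, and all other predicate variables are empty.\<close>
  define V where "V = (\<lambda>A. {})(PV 2 0 := same_block)"
  have VE: "V (PV 2 0) = same_block" by (simp add: V_def)
  have "{} \<in> preds Halving.M n" for n
    by (rule finite_pred_in_Halving[of "{}"]) auto
  then have "assignment Halving.M (\<lambda>_. 0) V"
    using same_block_in_Halving by (simp add: assignment_def V_def)
  with sat have "sat Halving.M (\<lambda>_. 0) V (choice_h 0 1 (PV 1 0) (PV 2 1) halving)"
    by (simp add: satisfies_def)
  moreover have "sat Halving.M (\<lambda>_. 0) V (AllI 0 (ExP (PV 1 0) halving))"
    using blocks_halvable[of V, OF VE] by simp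
  ultimately have "\<exists>S\<in>preds Halving.M 2. \<forall>a. \<exists>\<alpha>\<in>preds Halving.M 1.
      (\<forall>y. [y] \<in> \<alpha> \<longleftrightarrow> [a, y] \<in> S) \<and>
      sat Halving.M ((\<lambda>_. 0)(0 := a)) (V(PV 2 1 := S, PV 1 0 := \<alpha>)) halving"
    unfolding choice_h_def by simp
  then obtain S where S: "S \<in> preds Halving.M 2"
    and choice: "\<forall>a. \<exists>\<alpha>\<in>preds Halving.M 1. (\<forall>y. [y] \<in> \<alpha> \<longleftrightarrow> [a, y] \<in> S) \<and>
      sat Halving.M ((\<lambda>_. 0)(0 := a)) (V(PV 2 1 := S, PV 1 0 := \<alpha>)) halving"
    by (rule bexE)
  obtain P where P: "P \<in> block_ideal blk" "Halving.supports P S"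
    using S by (auto simp: Halving.preds_M)
  obtain k where k: "\<And>n. finite {a \<in> P. blk a = n}" "\<And>n. card {a \<in> P. blk a = n} \<le> k"
    using P(1) by (auto simp: block_ideal_def)
  \<comment> \<open>One above \<open>k\<close>, to leave room for \<open>x\<close> beside the at
    most \<open>k\<close> points of \<open>P\<close> in the block.\<close>
  define n where "n = Suc k"
  define B where "B = {a. blk a = n}"
  have B: "finite B" "2 * n < card B"
    using finite_block card_block by (simp_all add: B_def)
  then obtain x where "x \<in> B" by fastforce
  then have x: "blk x = n" by (simp add: B_def)
  obtain \<alpha> where \<alpha>: "\<And>y. [y] \<in> \<alpha> \<longleftrightarrow> [x, y] \<in> S"
    and "sat Halving.M ((\<lambda>_. 0)(0 := x)) (V(PV 2 1 := S, PV 1 0 := \<alpha>)) halving"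
    using choice by blast
  moreover have "(V(PV 2 1 := S, PV 1 0 := \<alpha>)) (PV 2 0) = same_block"
    using VE by simp
  ultimately obtain F where F: "\<And>u v w. [u, v] \<in> F \<Longrightarrow> [u, w] \<in> F \<Longrightarrow> v = w"
    and match: "\<And>u. blk u = n \<Longrightarrow> \<exists>v. blk v = n \<and> [v, u] \<in> F \<and> ([x, u] \<in> S \<longleftrightarrow> [x, v] \<notin> S)"
    using x sat_halving[of "V(PV 2 1 := S, PV 1 0 := \<alpha>)" "(\<lambda>_. 0)(0 := x)"] by (auto, metis)
  define X where "X = {u \<in> B. [x, u] \<in> S}"
  have X: "finite X" "finite (B - X)" using B(1) by (auto simp: X_def)
  \<comment> \<open>Partners lie on opposite sides, so the matching bounds each side by the other
    and both have equal size.\<close>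
  have m1: "\<exists>v\<in>B - X. [v, u] \<in> F" if "u \<in> X" for u
    using match[of u] that by (auto simp: X_def B_def)
  have le1: "card X \<le> card (B - X)"
    by (rule card_le_of_matching[of _ F, OF X(2)]) (fact F m1)+
  have m2: "\<exists>v\<in>X. [v, u] \<in> F" if "u \<in> B - X" for u
    using match[of u] that by (auto simp: X_def B_def)
  have le2: "card (B - X) \<le> card X"
    by (rule card_le_of_matching[of _ F, OF X(1)]) (fact F m2)+
  have "X \<subseteq> B" by (auto simp: X_def)
  then have sum: "card X + card (B - X) = card B"
    using card_Diff_subset[OF X(1)] card_mono[OF B(1)] by fastforce
  \<comment> \<open>With \<open>x\<close> in \<open>Q\<close>, transposing two points of
    \<open>B - Q\<close> fixes \<open>x\<close> as well as \<open>P\<close>, so it preserves the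
    section of \<open>S\<close> at \<open>x\<close>.\<close>
  define Q where "Q = insert x {a \<in> P. blk a = n}"
  have "card Q \<le> n"
    using k[of n] by (simp add: Q_def n_def card_insert_if)
  have Q: "finite Q" using k by (simp add: Q_def)
  have swap: "[x, u] \<in> S \<longleftrightarrow> [x, v] \<in> S" if "u \<in> B - Q" "v \<in> B - Q" for u v
  proof -
    have "map (transpose u v) [x, u] \<in> S \<longleftrightarrow> [x, u] \<in> S"
      by (rule Halving.supports_iff[OF P(2) Halving.transpose_block_group])
        (use that in \<open>auto simp: B_def Q_def transpose_def\<close>)
    moreover have "transpose u v x = x" using that by (auto simp: Q_def transpose_def)
    ultimately show ?thesis by simp
  qed
  \<comment> \<open>Points of \<open>B - Q\<close> are all on the same side, so the other side lies
    within \<open>Q\<close>. Both sides then have at most \<open>n\<close> points, against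
    \<open>2 * n < card B\<close>.\<close>
  have "X \<subseteq> Q \<or> B - X \<subseteq> Q"
    using swap by (auto simp: X_def)
  then have "card X \<le> n \<or> card (B - X) \<le> n"
    using card_mono[OF Q] \<open>card Q \<le> n\<close> by (meson order_trans)
  with le1 le2 sum B(2) show False by linarith
qed

theorem theorem3p2:
  shows "(\<exists>H x y D S. choice_vars x y D S H \<and>
            (\<exists>M :: nat pstruct. henkin_asser_structure M \<and>
               model_of M (hax2 \<union> {AC11}) \<and>
               \<not> satisfies M (choice_h x y D S H))) \<and>
         (henkin_asser_structure Sigma0 \<and>
          model_of Sigma0 (hax2 \<union> choice_h11 \<union> {AC11}))"
proof
  show "\<exists>H x y D S. choice_vars x y D S H \<and>
            (\<exists>M :: nat pstruct. henkin_asser_structure M \<and>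
               model_of M (hax2 \<union> {AC11}) \<and>
               \<not> satisfies M (choice_h x y D S H))"
    using choice_vars_halving Halving.henkin_asser_structure_M Halving.model_hax2_AC11
      Halving_not_satisfies_choice_h by blast
  have "model_of Sigma0 (hax2 \<union> {AC11})"
    unfolding Sigma0_eq by (rule Fraenkel.model_hax2_AC11)
  moreover have "model_of Sigma0 choice_h11"
    using Sigma0_satisfies_choice_h by (auto simp: model_of_def choice_h11_def)
  ultimately show "henkin_asser_structure Sigma0 \<and>
      model_of Sigma0 (hax2 \<union> choice_h11 \<union> {AC11})"
    using Fraenkel.henkin_asser_structure_M by (auto simp: model_of_def Sigma0_eq)
qed

end
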